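(* There is a deterministic adaptive algorithm and a function $f:\mathbb{N}\times\mathbb{N}\to\mathbb{N}$ with the following property. Let $G=(V,E)$ be a hidden connected graph with $n\ge 2$ vertices and maximum degree $\Delta$, let $\tau$ be an integer with $\tau\ge \mathrm{tl}(G)$, and suppose the algorithm is given $V$ and $\tau$ together with access to a shortest-path distance oracle for $G$. Then the algorithm determines $E$ exactly, using at most $f(\Delta,\tau)\cdot n\log n$ oracle queries. (The paper states the bound as $O(\Delta^{3\tau+2}\cdot n\log n)$, treating $\Delta$ and $\tau$ as constants.)
   Context: All graphs are simple, unweighted, undirected and connected. Shortest-path distance oracle: given $u,v\in V$ it returns $d_G(u,v)$, the length of a shortest $u$-$v$ path in $G$; each such call counts as one query, and queries may be chosen adaptively. The algorithm knows only $V$ and $\tau$ initially; reconstruction is complete when $E$ is determined. A tree decomposition of $G$ is a pair $(T,\{V_t\}_{t\in V(T)})$ with $T$ a tree and $V_t\subseteq V$ such that every vertex lies in some bag, every edge has both endpoints in some bag, and for each vertex $v$ the set of $t$ with $v\in V_t$ induces a connected subtree of $T$. The treelength $\mathrm{tl}(G)$ is the minimum over tree decompositions of $\max_t\max_{u,v\in V_t} d_G(u,v)$. *)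

theory Defs
  imports Complex_Main
begin

definition graph_on :: "'a set \<Rightarrow> ('a \<Rightarrow> 'a \<Rightarrow> bool) \<Rightarrow> bool" where
  "graph_on V E \<longleftrightarrow> (\<forall>u v. E u v \<longrightarrow> u \<in> V \<and> v \<in> V \<and> u \<noteq> v \<and> E v u)"

definition walk :: "('a \<Rightarrow> 'a \<Rightarrow> bool) \<Rightarrow> 'a list \<Rightarrow> bool" where
  "walk E xs \<longleftrightarrow> (\<forall>i. Suc i < length xs \<longrightarrow> E (xs ! i) (xs ! Suc i))"

definition connected_on :: "'a set \<Rightarrow> ('a \<Rightarrow> 'a \<Rightarrow> bool) \<Rightarrow> bool" where
  "connected_on V E \<longleftrightarrow>
     (\<forall>u\<in>V. \<forall>v\<in>V. \<exists>xs. xs \<noteq> [] \<and> walk E xs \<and> hd xs = u \<and> last xs = v \<and> set xs \<subseteq> V)"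

definition dist :: "('a \<Rightarrow> 'a \<Rightarrow> bool) \<Rightarrow> 'a \<Rightarrow> 'a \<Rightarrow> nat" where
  "dist E u v = (LEAST k. \<exists>xs. walk E xs \<and> xs \<noteq> [] \<and> hd xs = u \<and> last xs = v \<and> length xs = Suc k)"

definition maxdeg :: "'a set \<Rightarrow> ('a \<Rightarrow> 'a \<Rightarrow> bool) \<Rightarrow> nat" where
  "maxdeg V E = Max ((\<lambda>u. card {v. E u v}) ` V)"

definition is_tree :: "'b set \<Rightarrow> ('b \<Rightarrow> 'b \<Rightarrow> bool) \<Rightarrow> bool" where
  "is_tree N TE \<longleftrightarrow> finite N \<and> N \<noteq> {} \<and> graph_on N TE \<and> connected_on N TE \<and>
     \<not> (\<exists>xs. walk TE xs \<and> distinct xs \<and> length xs \<ge> 3 \<and> TE (last xs) (hd xs))"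

definition tree_decomp :: "'a set \<Rightarrow> ('a \<Rightarrow> 'a \<Rightarrow> bool) \<Rightarrow> 'b set \<Rightarrow> ('b \<Rightarrow> 'b \<Rightarrow> bool) \<Rightarrow> ('b \<Rightarrow> 'a set) \<Rightarrow> bool" where
  "tree_decomp V E N TE B \<longleftrightarrow>
     is_tree N TE \<and>
     (\<forall>t\<in>N. B t \<subseteq> V) \<and>
     (\<forall>v\<in>V. \<exists>t\<in>N. v \<in> B t) \<and>
     (\<forall>u v. E u v \<longrightarrow> (\<exists>t\<in>N. u \<in> B t \<and> v \<in> B t)) \<and>
     (\<forall>v\<in>V. connected_on {t\<in>N. v \<in> B t} (\<lambda>s t. TE s t \<and> v \<in> B s \<and> v \<in> B t))"

definition treelength :: "'a set \<Rightarrow> ('a \<Rightarrow> 'a \<Rightarrow> bool) \<Rightarrow> nat" where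
  "treelength V E = (LEAST l. \<exists>(N :: nat set) TE B. tree_decomp V E N TE B \<and>
       (\<forall>t\<in>N. \<forall>u\<in>B t. \<forall>v\<in>B t. dist E u v \<le> l))"

(* Deterministic adaptive query algorithm = decision tree: either output an edge set,
   or query the oracle on (u,v) and continue depending on the answer. *)
datatype qtree = Output "(nat \<times> nat) set" | Query nat nat "nat \<Rightarrow> qtree"

primrec run :: "qtree \<Rightarrow> (nat \<Rightarrow> nat \<Rightarrow> nat) \<Rightarrow> (nat \<times> nat) set \<times> nat" where
  "run (Output S) d = (S, 0)"
| "run (Query u v k) d = (let r = run (k (d u v)) d in (fst r, Suc (snd r)))"

end

theory Submission
  imports Defs
begin

text \<open>Vertices are inserted in order of their distance to the root \<open>0\<close>, keeping the subgraph induced by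
  the inserted set \<open>X\<close> known. Since a bag of a tree decomposition meets every member of a pairwise
  intersecting family of connected sets, (i) vertices of one layer joined by a walk in higher layers are
  within distance \<open>3\<tau>\<close>, so any walk leaving \<open>X\<close> can be replaced by a detour of bounded length inside
  \<open>X\<close>, and (ii) every \<open>W \<subseteq> X\<close> has a balanced separator \<open>S\<close> of bounded size in the known graph.
  To insert \<open>u\<close>, query its distances to a ball of bounded radius around \<open>S\<close>. Either the nearest queried
  vertex is a neighbour of \<open>u\<close>, or a shortest path from it to \<open>u\<close> stays far from \<open>S\<close>, and then all
  neighbours of \<open>u\<close> in \<open>X\<close> lie in its component of \<open>X - S\<close>, which halves the set \<open>W\<close> of candidates.
  Once one neighbour is found, the others lie in a bounded ball around it.\<close>

section \<open>Walks, balls and distances\<close>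

text \<open>Connectivity by reachability in a relation serves alike for the hidden graph, the known
  subgraph and the decomposition tree. The empty set counts as connected.\<close>

definition conn_set :: "('a \<times> 'a) set \<Rightarrow> 'a set \<Rightarrow> bool" where
  "conn_set R A \<longleftrightarrow> (\<forall>x\<in>A. \<forall>y\<in>A. (x, y) \<in> (Restr R A)\<^sup>*)"

text \<open>Iterated neighbourhoods depend on the relation only, so the algorithm can compute them
  in the known subgraph without queries.\<close>

primrec ball :: "('a \<times> 'a) set \<Rightarrow> nat \<Rightarrow> 'a set \<Rightarrow> 'a set" where
  "ball R 0 A = A"
| "ball R (Suc k) A = ball R k A \<union> R `` ball R k A"

lemma ball_mono_rad: "k \<le> l \<Longrightarrow> ball R k A \<subseteq> ball R l A"
  by (induction l) (auto simp: le_Suc_eq)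

lemma ball_add: "ball R (k + l) A = ball R l (ball R k A)"
  by (induction l) auto

lemma ball_mono: "A \<subseteq> A' \<Longrightarrow> ball R k A \<subseteq> ball R k A'"
  by (induction k) auto

lemma ball_center: "A \<subseteq> ball R k A"
  using ball_mono_rad[of 0 k R A] by simp

lemma ball_trans:
  assumes "y \<in> ball R k A" "z \<in> ball R l {y}"
  shows "z \<in> ball R (k + l) A"
  using assms ball_mono[of "{y}" "ball R k A" R l] by (auto simp: ball_add)

lemma ball_subset:
  assumes "R \<subseteq> X \<times> X" "A \<subseteq> X"
  shows "ball R k A \<subseteq> X"
  using assms by (induction k) auto

lemma ball_sym:
  assumes "sym R" "y \<in> ball R k {x}"
  shows "x \<in> ball R k {y}"
  using assms(2)
proof (induction k arbitrary: y)
  case (Suc k)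
  show ?case
  proof (cases "y \<in> ball R k {x}")
    case True
    then show ?thesis using Suc.IH by auto
  next
    case False
    with Suc.prems obtain w where w: "w \<in> ball R k {x}" "(w, y) \<in> R" by auto
    have "w \<in> ball R 1 {y}" using w(2) assms(1) by (auto dest: symD)
    then have "x \<in> ball R (1 + k) {y}" by (rule ball_trans) (rule Suc.IH[OF w(1)])
    then show ?thesis by simp
  qed
qed simp

lemma card_ball_le:
  assumes "finite A" and "\<And>x. finite (R `` {x})" and deg: "\<And>x. card (R `` {x}) \<le> D"
  shows "finite (ball R k A) \<and> card (ball R k A) \<le> card A * (D + 1) ^ k"
proof (induction k)
  case (Suc k)
  let ?B = "ball R k A"
  have eq: "R `` ?B = (\<Union>x\<in>?B. R `` {x})" by auto
  have "card (R `` ?B) \<le> (\<Sum>x\<in>?B. card (R `` {x}))"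
    unfolding eq using Suc by (intro card_UN_le) auto
  also have "\<dots> \<le> card ?B * D"
    using sum_bounded_above[of ?B "\<lambda>x. card (R `` {x})" D] deg by simp
  finally have "card (ball R (Suc k) A) \<le> card ?B * (D + 1)"
    using card_Un_le[of ?B "R `` ?B"] by simp
  also have "\<dots> \<le> card A * (D + 1) ^ k * (D + 1)"
    using Suc by (intro mult_right_mono) auto
  finally show ?case using Suc assms(2) eq by (auto simp: mult_ac)
qed (use assms in simp)

text \<open>A walk of at most \<open>k\<close> steps from \<open>a\<close> that met \<open>S\<close>
  would, read backwards, put \<open>a\<close> within \<open>k\<close> of \<open>S\<close>.\<close>

lemma ball_avoiding:
  assumes "sym R" "b \<in> ball R k {a}" "a \<notin> ball R k S"
  shows "(a, b) \<in> (Restr R (- S))\<^sup>*"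
  using assms(2,3)
proof (induction k arbitrary: b)
  case (Suc k)
  have a: "a \<notin> ball R k S" using Suc.prems(2) by simp
  show ?case
  proof (cases "b \<in> ball R k {a}")
    case True
    then show ?thesis using Suc.IH a by blast
  next
    case False
    with Suc.prems(1) obtain c where c: "c \<in> ball R k {a}" "(c, b) \<in> R" by auto
    have notS: "x \<notin> S" if "x \<in> ball R (Suc k) {a}" for x
      using ball_sym[OF assms(1) that] ball_mono[of "{x}" S R "Suc k"] Suc.prems(2) by blast
    have "b \<notin> S" "c \<notin> S" using notS Suc.prems(1) c(1) by auto
    then have "(c, b) \<in> Restr R (- S)" using c by auto
    with Suc.IH[OF c(1) a] show ?thesis by (rule rtrancl_into_rtrancl)
  qed
qed simp

lemma sym_Restr: "sym R \<Longrightarrow> sym (Restr R A)"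
  by (auto simp: sym_def)

lemma conn_set_reachable:
  assumes "sym R"
  shows "conn_set R {x. (y, x) \<in> (Restr R D)\<^sup>*}" (is "conn_set R ?C")
proof -
  have step: "(y, x) \<in> (Restr R ?C)\<^sup>*" if "(y, x) \<in> (Restr R D)\<^sup>*" for x
    using that
  proof (induction rule: rtrancl_induct)
    case (step x z)
    then have "(x, z) \<in> Restr R ?C" by (auto intro: rtrancl_into_rtrancl)
    with step.IH show ?case by (rule rtrancl_into_rtrancl)
  qed simp
  have "sym ((Restr R ?C)\<^sup>*)" using sym_Restr[OF assms] by (intro sym_rtrancl) blast
  then show ?thesis unfolding conn_set_def
    using step by (blast dest: symD intro: rtrancl_trans)
qed

lemma walk_rtrancl:
  assumes "walk E xs" "xs \<noteq> []" "set xs \<subseteq> A"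
  shows "(hd xs, last xs) \<in> (Restr {(x, y). E x y} A)\<^sup>*"
  using assms
proof (induction xs rule: rev_induct)
  case (snoc z xs)
  show ?case
  proof (cases "xs = []")
    case False
    have w: "walk E xs" unfolding walk_def
    proof (intro allI impI)
      fix i assume "Suc i < length xs"
      then show "E (xs ! i) (xs ! Suc i)"
        using snoc.prems(1) unfolding walk_def by (auto simp: nth_append dest!: spec[of _ i])
    qed
    have "E (last xs) z"
      using snoc.prems(1) False unfolding walk_def
      by (auto simp: nth_append last_conv_nth dest!: spec[of _ "length xs - 1"])
    then have "(last xs, z) \<in> Restr {(x, y). E x y} A" using snoc.prems(3) False by auto
    moreover have "(hd xs, last xs) \<in> (Restr {(x, y). E x y} A)\<^sup>*"
      using snoc.IH[OF w False] snoc.prems(3) by auto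
    ultimately have "(hd xs, z) \<in> (Restr {(x, y). E x y} A)\<^sup>*" by (rule rtrancl_into_rtrancl[rotated])
    then show ?thesis using False by simp
  qed simp
qed simp

lemma connected_on_conn_set:
  assumes "connected_on A E"
  shows "conn_set {(x, y). E x y} A"
  using assms unfolding connected_on_def conn_set_def by (metis walk_rtrancl)

lemma walk_snoc:
  assumes "walk E xs" "xs \<noteq> []" "E (last xs) z"
  shows "walk E (xs @ [z])"
  unfolding walk_def
proof (intro allI impI)
  fix i assume i: "Suc i < length (xs @ [z])"
  show "E ((xs @ [z]) ! i) ((xs @ [z]) ! Suc i)"
  proof (cases "Suc i < length xs")
    case True
    then show ?thesis using assms(1) by (simp add: walk_def nth_append)
  next
    case False
    then have "i = length xs - 1" using i by simp
    then show ?thesis using assms(2,3) by (simp add: nth_append last_conv_nth)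
  qed
qed

lemma walk_take: "walk E xs \<Longrightarrow> walk E (take k xs)"
  by (auto simp: walk_def)

text \<open>Supplies the distinct walks that acyclicity in \<open>is_tree\<close> speaks of. If the
  next vertex already occurs, the walk is cut back to it instead of extended.\<close>

lemma rtrancl_distinct_walk:
  assumes "(x, y) \<in> {(x, y). E x y}\<^sup>*"
  shows "\<exists>xs. walk E xs \<and> distinct xs \<and> xs \<noteq> [] \<and> hd xs = x \<and> last xs = y"
  using assms
proof (induction rule: rtrancl_induct)
  case base
  show ?case by (rule exI[of _ "[x]"]) (simp add: walk_def)
next
  case (step y z)
  then obtain xs where xs: "walk E xs" "distinct xs" "xs \<noteq> []" "hd xs = x" "last xs = y" by blast
  show ?case
  proof (cases "z \<in> set xs")
    case True
    then obtain i where i: "i < length xs" "xs ! i = z" by (auto simp: in_set_conv_nth)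
    have "last (take (Suc i) xs) = z"
      using i by (simp add: take_Suc_conv_app_nth)
    then show ?thesis using xs i
      by (intro exI[of _ "take (Suc i) xs"]) (auto simp: walk_take hd_take)
  next
    case False
    then show ?thesis using xs step.hyps
      by (intro exI[of _ "xs @ [z]"]) (auto intro!: walk_snoc)
  qed
qed

lemma ball_iff_walk:
  fixes k :: nat
  shows "y \<in> ball {(x, y). E x y} k {x} \<longleftrightarrow>
    (\<exists>xs. walk E xs \<and> xs \<noteq> [] \<and> hd xs = x \<and> last xs = y \<and> length xs \<le> Suc k)"
proof
  show "\<exists>xs. walk E xs \<and> xs \<noteq> [] \<and> hd xs = x \<and> last xs = y \<and> length xs \<le> Suc k"
    if "y \<in> ball {(x, y). E x y} k {x}"
    using that
  proof (induction k arbitrary: y)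
    case 0
    then show ?case by (intro exI[of _ "[x]"]) (simp add: walk_def)
  next
    case (Suc k)
    show ?case
    proof (cases "y \<in> ball {(x, y). E x y} k {x}")
      case True
      then show ?thesis using Suc.IH le_SucI by blast
    next
      case False
      with Suc.prems obtain w where w: "w \<in> ball {(x, y). E x y} k {x}" "E w y" by auto
      from Suc.IH[OF w(1)] obtain xs where
        "walk E xs" "xs \<noteq> []" "hd xs = x" "last xs = w" "length xs \<le> Suc k" by blast
      with w(2) show ?thesis
        by (intro exI[of _ "xs @ [y]"]) (simp add: walk_snoc)
    qed
  qed
  have last_in: "last xs \<in> ball {(x, y). E x y} (length xs - 1) {hd xs}" if "walk E xs" "xs \<noteq> []" for xs
    using that
  proof (induction xs rule: rev_induct)
    case (snoc z xs)
    show ?case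
    proof (cases "xs = []")
      case False
      have "walk E xs" using walk_take[OF snoc.prems(1), of "length xs"] by simp
      then have IH: "last xs \<in> ball {(x, y). E x y} (length xs - 1) {hd xs}"
        using snoc.IH False by blast
      have "E (last xs) z"
        using snoc.prems(1) False unfolding walk_def
        by (auto simp: nth_append last_conv_nth dest!: spec[of _ "length xs - 1"])
      then have "z \<in> ball {(x, y). E x y} (Suc (length xs - 1)) {hd xs}" using IH by auto
      then show ?thesis using False by (simp del: ball.simps)
    qed simp
  qed simp
  show "y \<in> ball {(x, y). E x y} k {x}"
    if "\<exists>xs. walk E xs \<and> xs \<noteq> [] \<and> hd xs = x \<and> last xs = y \<and> length xs \<le> Suc k"
  proof -
    from that obtain xs where xs: "walk E xs" "xs \<noteq> []" "hd xs = x" "last xs = y" "length xs \<le> Suc k"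
      by blast
    have "y \<in> ball {(x, y). E x y} (length xs - 1) {x}"
      using last_in[OF xs(1,2)] xs(3,4) by simp
    moreover have "length xs - 1 \<le> k" using xs(5) by simp
    ultimately show ?thesis by (rule subsetD[OF ball_mono_rad, rotated])
  qed
qed

lemma ball_rtrancl: "(x, y) \<in> R\<^sup>* \<Longrightarrow> \<exists>k. y \<in> ball R k {x}"
proof (induction rule: rtrancl_induct)
  case base
  show ?case by (rule exI[of _ 0]) simp
next
  case (step y z)
  then obtain k where "y \<in> ball R k {x}" by blast
  with step.hyps show ?case by (intro exI[of _ "Suc k"]) auto
qed

text \<open>Reachability makes the set under \<open>LEAST\<close> nonempty, so that
  \<open>dist\<close> is the length of an actual walk.\<close>

lemma dist_le_iff_ball:
  assumes "(x, y) \<in> {(x, y). E x y}\<^sup>*"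
  shows "dist E x y \<le> k \<longleftrightarrow> y \<in> ball {(x, y). E x y} k {x}"
proof -
  define P where "P k \<longleftrightarrow> (\<exists>xs. walk E xs \<and> xs \<noteq> [] \<and> hd xs = x \<and> last xs = y \<and> length xs = Suc k)" for k
  have ball_P: "y \<in> ball {(x, y). E x y} k {x} \<longleftrightarrow> (\<exists>j\<le>k. P j)" for k
  proof
    assume "y \<in> ball {(x, y). E x y} k {x}"
    then obtain xs where xs: "walk E xs" "xs \<noteq> []" "hd xs = x" "last xs = y" "length xs \<le> Suc k"
      unfolding ball_iff_walk by blast
    then obtain j where j: "length xs = Suc j" by (cases xs) auto
    with xs show "\<exists>j\<le>k. P j" unfolding P_def by (intro exI[of _ j]) auto
  next
    assume "\<exists>j\<le>k. P j"
    then show "y \<in> ball {(x, y). E x y} k {x}" unfolding ball_iff_walk P_def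
      by (metis (no_types, lifting) Suc_le_mono eq_imp_le le_SucI le_trans)
  qed
  have dist: "dist E x y = (LEAST k. P k)" unfolding dist_def P_def by (rule refl)
  have "\<exists>k. P k" using ball_rtrancl[OF assms] ball_P by blast
  then have "P (dist E x y)" unfolding dist by (rule LeastI_ex)
  moreover have "dist E x y \<le> j" if "P j" for j unfolding dist using that by (rule Least_le)
  ultimately show ?thesis unfolding ball_P by (meson order_trans)
qed

section \<open>Brambles and tree decompositions\<close>

text \<open>The component of \<open>s\<close> once the edge between \<open>s\<close> and
  \<open>t\<close> is deleted.\<close>

definition tree_side :: "('b \<Rightarrow> 'b \<Rightarrow> bool) \<Rightarrow> 'b \<Rightarrow> 'b \<Rightarrow> 'b set" where
  "tree_side TE t s = {x. (s, x) \<in> ({(x, y). TE x y} - {(s, t), (t, s)})\<^sup>*}"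

text \<open>A distinct walk from \<open>s\<close> to \<open>t\<close> avoiding their edge would be
  closed to a cycle by that edge.\<close>

lemma tree_edge_bridge:
  assumes tree: "is_tree N TE" and st: "TE s t"
  shows "t \<notin> tree_side TE t s"
proof
  let ?E = "\<lambda>x y. TE x y \<and> (x, y) \<noteq> (s, t) \<and> (x, y) \<noteq> (t, s)"
  have g: "graph_on N TE" using tree by (simp add: is_tree_def)
  assume "t \<in> tree_side TE t s"
  moreover have "{(x, y). TE x y} - {(s, t), (t, s)} = {(x, y). ?E x y}" by auto
  ultimately have "(s, t) \<in> {(x, y). ?E x y}\<^sup>*" unfolding tree_side_def by auto
  from rtrancl_distinct_walk[OF this] obtain xs
    where xs: "walk ?E xs" "distinct xs" "xs \<noteq> []" "hd xs = s" "last xs = t" by blast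
  have "s \<noteq> t" "TE t s" using g st by (auto simp: graph_on_def)
  have "length xs \<ge> 3"
  proof (rule ccontr)
    assume "\<not> 3 \<le> length xs"
    then consider "length xs = 1" | "length xs = 2" using xs(3)
      by (cases "length xs") (auto simp: numeral_eq_Suc not_le less_Suc_eq)
    then show False
    proof cases
      case 1
      then show False using xs \<open>s \<noteq> t\<close> by (cases xs) auto
    next
      case 2
      then obtain a b where "xs = [a, b]" by (auto simp: length_Suc_conv numeral_2_eq_2)
      then show False using xs by (auto simp: walk_def)
    qed
  qed
  moreover have "walk TE xs" using xs(1) by (auto simp: walk_def)
  ultimately show False using tree xs \<open>TE t s\<close> unfolding is_tree_def by metis
qed

text \<open>Cut the walk at its last visit to \<open>t\<close>; the rest avoids
  \<open>t\<close>.\<close>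

lemma rtrancl_first_step:
  assumes "(t, x) \<in> T\<^sup>*" "x \<noteq> t"
  shows "\<exists>s. (t, s) \<in> T \<and> s \<noteq> t \<and> (s, x) \<in> (Restr T (- {t}))\<^sup>*"
  using assms
proof (induction rule: rtrancl_induct)
  case (step y z)
  show ?case
  proof (cases "y = t")
    case True
    then show ?thesis using step by blast
  next
    case False
    then obtain s where s: "(t, s) \<in> T" "s \<noteq> t" "(s, y) \<in> (Restr T (- {t}))\<^sup>*" using step by blast
    have "(y, z) \<in> Restr T (- {t})" using step False by auto
    with s show ?thesis by (blast intro: rtrancl_into_rtrancl)
  qed
qed simp

text \<open>Each bag missing some set of the family points to the neighbouring bag on the side of that set.
  A pointer to a side of minimal size is answered by a pointer back, so two disjoint sides
  contain two sets of the family.\<close>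

lemma bag_hits_bramble:
  assumes td: "tree_decomp V E N TE B"
    and conn: "\<And>A. A \<in> F \<Longrightarrow> A \<subseteq> V \<and> conn_set {(x, y). E x y} A"
    and meet: "\<And>A A'. A \<in> F \<Longrightarrow> A' \<in> F \<Longrightarrow> A \<inter> A' \<noteq> {}"
  shows "\<exists>t\<in>N. \<forall>A\<in>F. A \<inter> B t \<noteq> {}"
proof (rule ccontr)
  let ?T = "{(x, y). TE x y}"
  define nodes where "nodes A = {t \<in> N. B t \<inter> A \<noteq> {}}" for A
  have tree: "is_tree N TE" using td by (simp add: tree_decomp_def)
  then have fin: "finite N" and g: "graph_on N TE" and ne: "N \<noteq> {}" and cN: "conn_set ?T N"
    by (auto simp: is_tree_def connected_on_conn_set)
  have symT: "sym ?T" using g by (auto simp: graph_on_def sym_def)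
  have sub: "?T \<subseteq> N \<times> N" using g by (auto simp: graph_on_def)
  have cv: "(s, t) \<in> (Restr ?T (nodes A))\<^sup>*"
    if "v \<in> A" "v \<in> V" "s \<in> N" "t \<in> N" "v \<in> B s" "v \<in> B t" for v s t A
  proof -
    have "conn_set {(s, t). TE s t \<and> v \<in> B s \<and> v \<in> B t} {t \<in> N. v \<in> B t}"
      using td that by (intro connected_on_conn_set) (auto simp: tree_decomp_def)
    then have *: "(s, t) \<in> (Restr {(s, t). TE s t \<and> v \<in> B s \<and> v \<in> B t} {t \<in> N. v \<in> B t})\<^sup>*"
      using that by (auto simp: conn_set_def)
    show ?thesis by (rule subsetD[OF rtrancl_mono *]) (use that in \<open>auto simp: nodes_def\<close>)
  qed
  \<comment> \<open>Follow a walk inside \<open>A\<close>: consecutive vertices share a bag, and the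
    bags holding one fixed vertex are connected by \<open>cv\<close>.\<close>
  have cnodes: "(s, t) \<in> (Restr ?T (nodes A))\<^sup>*" if A: "A \<in> F" and st: "s \<in> nodes A" "t \<in> nodes A" for s t A
  proof -
    obtain v w where v: "v \<in> A" "v \<in> B s" "s \<in> N" and w: "w \<in> A" "w \<in> B t" "t \<in> N"
      using st by (auto simp: nodes_def)
    have AV: "A \<subseteq> V" using conn[OF A] by simp
    have "(v, w) \<in> (Restr {(x, y). E x y} A)\<^sup>*" using conn[OF A] v w by (auto simp: conn_set_def)
    then have "\<forall>t\<in>N. w \<in> B t \<longrightarrow> (s, t) \<in> (Restr ?T (nodes A))\<^sup>*"
    proof (induction rule: rtrancl_induct)
      case base
      then show ?case using cv[of v A s] v AV by auto
    next
      case (step y z)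
      then have yz: "E y z" "y \<in> A" "z \<in> A" by auto
      obtain r where r: "r \<in> N" "y \<in> B r" "z \<in> B r"
        using td yz(1) unfolding tree_decomp_def by blast
      show ?case
      proof (intro ballI impI)
        fix t assume t: "t \<in> N" "z \<in> B t"
        have "(s, r) \<in> (Restr ?T (nodes A))\<^sup>*" using step.IH r by blast
        moreover have "(r, t) \<in> (Restr ?T (nodes A))\<^sup>*" using cv[of z A r t] r t yz AV by auto
        ultimately show "(s, t) \<in> (Restr ?T (nodes A))\<^sup>*" by (rule rtrancl_trans)
      qed
    qed
    then show ?thesis using w by blast
  qed
  have nodes_ne: "nodes {v} \<noteq> {}" if "v \<in> V" for v
    using td that unfolding tree_decomp_def nodes_def by blast
  assume "\<not> (\<exists>t\<in>N. \<forall>A\<in>F. A \<inter> B t \<noteq> {})"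
  then have "\<forall>t\<in>N. \<exists>A\<in>F. A \<inter> B t = {}" by blast
  then obtain a where a: "\<And>t. t \<in> N \<Longrightarrow> a t \<in> F \<and> a t \<inter> B t = {}" by metis
  \<comment> \<open>The bag at \<open>t\<close> misses \<open>a t\<close>, so the connected set of
    nodes meeting \<open>a t\<close> avoids \<open>t\<close> and lies on one side of it.\<close>
  have dir: "\<exists>s. TE t s \<and> nodes (a t) \<subseteq> tree_side TE t s" if t: "t \<in> N" for t
  proof -
    obtain v where "v \<in> a t" "v \<in> V" using a[OF t] meet[of "a t" "a t"] conn[of "a t"] by blast
    then obtain x where x: "x \<in> nodes (a t)" "x \<in> N"
      using nodes_ne[of v] by (auto simp: nodes_def)
    have tn: "t \<notin> nodes (a t)" using a[OF t] by (auto simp: nodes_def)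
    have "(t, x) \<in> ?T\<^sup>*" using cN t x(2) unfolding conn_set_def
      by (meson Int_lower1 rtrancl_mono subsetD)
    moreover have "x \<noteq> t" using x tn by auto
    ultimately obtain s where s: "(t, s) \<in> ?T" "s \<noteq> t" "(s, x) \<in> (Restr ?T (- {t}))\<^sup>*"
      using rtrancl_first_step by metis
    have "y \<in> tree_side TE t s" if y: "y \<in> nodes (a t)" for y
    proof -
      have "(x, y) \<in> (Restr ?T (nodes (a t)))\<^sup>*" using cnodes x y a[OF t] by blast
      moreover have "Restr ?T (nodes (a t)) \<subseteq> Restr ?T (- {t})" using tn by auto
      ultimately have "(x, y) \<in> (Restr ?T (- {t}))\<^sup>*" using rtrancl_mono by blast
      with s(3) have "(s, y) \<in> (Restr ?T (- {t}))\<^sup>*" by (rule rtrancl_trans)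
      moreover have "Restr ?T (- {t}) \<subseteq> ?T - {(s, t), (t, s)}" by auto
      ultimately show ?thesis unfolding tree_side_def using rtrancl_mono by blast
    qed
    then show ?thesis using s by blast
  qed
  define P where "P = (\<lambda>(t, s). TE t s \<and> nodes (a t) \<subseteq> tree_side TE t s)"
  have "\<exists>p. P p" using dir ne unfolding P_def by fast
  then obtain p where p: "P p" and least: "\<And>q. P q \<Longrightarrow> card (case_prod (tree_side TE) p) \<le> card (case_prod (tree_side TE) q)"
    using ex_has_least_nat[of P _ "\<lambda>p. card (case_prod (tree_side TE) p)"] by blast
  obtain t s where ts: "p = (t, s)" by (cases p)
  have TE: "TE t s" and in_s: "nodes (a t) \<subseteq> tree_side TE t s" using p ts by (auto simp: P_def)
  have sN: "s \<in> N" and tN: "t \<in> N" using TE sub by auto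
  obtain r where TEr: "TE s r" and in_r: "nodes (a s) \<subseteq> tree_side TE s r" using dir[OF sN] by blast
  have symTE: "TE x y \<Longrightarrow> TE y x" for x y using symT by (auto simp: sym_def)
  show False
  proof (cases "r = t")
    \<comment> \<open>The pointers at \<open>s\<close> and \<open>t\<close> face each other. A
      vertex common to \<open>a t\<close> and \<open>a s\<close> has a bag on both sides, which
      joins \<open>s\<close> to \<open>t\<close> without their edge.\<close>
    case True
    obtain v where v: "v \<in> a t" "v \<in> a s" "v \<in> V" using meet[of "a t" "a s"] a[OF sN] a[OF tN] conn[of "a t"] by blast
    obtain x where "x \<in> nodes {v}" using nodes_ne[OF v(3)] by blast
    then have "x \<in> nodes (a t)" "x \<in> nodes (a s)" using v by (auto simp: nodes_def)
    then have x: "(s, x) \<in> (?T - {(s, t), (t, s)})\<^sup>*" "(t, x) \<in> (?T - {(s, t), (t, s)})\<^sup>*"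
      using in_s in_r True by (auto simp: tree_side_def insert_commute)
    have "sym (?T - {(s, t), (t, s)})" using symT by (auto simp: sym_def)
    then have "(x, t) \<in> (?T - {(s, t), (t, s)})\<^sup>*" using x(2) by (meson sym_rtrancl symD)
    with x(1) have "(s, t) \<in> (?T - {(s, t), (t, s)})\<^sup>*" by (rule rtrancl_trans)
    then have "t \<in> tree_side TE t s" by (simp add: tree_side_def)
    then show False using tree_edge_bridge[OF tree symTE[OF TE]] by simp
  next
    \<comment> \<open>The pointer at \<open>s\<close> leads further away, so its side is a proper
      subset of the side of minimal size.\<close>
    case False
    have bridge: "s \<notin> tree_side TE s r" by (rule tree_edge_bridge[OF tree symTE[OF TEr]])
    have "y \<in> tree_side TE t s" if "y \<in> tree_side TE s r" for y
    proof -
      have "(r, y) \<in> (?T - {(r, s), (s, r)})\<^sup>*" using that by (simp add: tree_side_def)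
      then have "(s, y) \<in> (?T - {(s, t), (t, s)})\<^sup>*"
      proof (induction rule: rtrancl_induct)
        case base
        show ?case using TEr False TE sN symTE g by (intro r_into_rtrancl) (auto simp: graph_on_def)
      next
        case (step y z)
        have "y \<in> tree_side TE s r" "z \<in> tree_side TE s r"
          using step.hyps by (auto simp: tree_side_def intro: rtrancl_into_rtrancl)
        then have "y \<noteq> s" "z \<noteq> s" using bridge by auto
        then have "(y, z) \<in> ?T - {(s, t), (t, s)}" using step.hyps by auto
        with step.IH show ?case by (rule rtrancl_into_rtrancl)
      qed
      then show ?thesis by (simp add: tree_side_def)
    qed
    moreover have "s \<in> tree_side TE t s" by (simp add: tree_side_def)
    ultimately have "tree_side TE s r \<subset> tree_side TE t s" using bridge by blast
    moreover have "tree_side TE t s \<subseteq> N"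
    proof
      fix x assume "x \<in> tree_side TE t s"
      then have "(s, x) \<in> (?T - {(s, t), (t, s)})\<^sup>*" by (simp add: tree_side_def)
      then show "x \<in> N" by (induction rule: rtrancl_induct) (use sN sub in auto)
    qed
    ultimately have "card (tree_side TE s r) < card (tree_side TE t s)"
      using fin by (meson finite_subset psubset_card_mono)
    moreover have "P (s, r)" using TEr in_r by (simp add: P_def)
    ultimately show False using least ts by fastforce
  qed
qed

text \<open>Two vertical legs of at most \<open>3 * \<tau> + 1\<close> steps each and a horizontal
  one of at most \<open>3 * \<tau>\<close>; see \<open>reroute\<close>.\<close>

definition detour :: "nat \<Rightarrow> nat" where
  "detour \<tau> = 9 * \<tau> + 2"

section \<open>Layers of a graph of bounded treelength\<close>

locale tl_graph =
  fixes V :: "'a set" and E :: "'a \<Rightarrow> 'a \<Rightarrow> bool" and root :: 'a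
    and N :: "'b set" and TE :: "'b \<Rightarrow> 'b \<Rightarrow> bool" and B :: "'b \<Rightarrow> 'a set" and \<tau> :: nat
  assumes graph: "graph_on V E" and conn: "connected_on V E"
    and fin: "finite V" and root: "root \<in> V"
    and td: "tree_decomp V E N TE B"
    and bags: "\<And>t x y. t \<in> N \<Longrightarrow> x \<in> B t \<Longrightarrow> y \<in> B t \<Longrightarrow> dist E x y \<le> \<tau>"
begin

abbreviation R where "R \<equiv> {(x, y). E x y}"
abbreviation lev where "lev \<equiv> dist E root"

lemma symR: "sym R" and R_sub: "R \<subseteq> V \<times> V" and irreflR: "\<not> E x x"
  and E_sym: "E x y \<Longrightarrow> E y x" and E_V: "E x y \<Longrightarrow> x \<in> V" "E x y \<Longrightarrow> y \<in> V"
  using graph by (auto simp: graph_on_def sym_def)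

lemma reach: "x \<in> V \<Longrightarrow> y \<in> V \<Longrightarrow> (x, y) \<in> R\<^sup>*"
  using connected_on_conn_set[OF conn] unfolding conn_set_def
  by (meson Int_lower1 rtrancl_mono subsetD)

lemma dist_le_iff: "x \<in> V \<Longrightarrow> y \<in> V \<Longrightarrow> dist E x y \<le> k \<longleftrightarrow> y \<in> ball R k {x}"
  using reach by (rule dist_le_iff_ball)

lemma dist_0_iff: "x \<in> V \<Longrightarrow> y \<in> V \<Longrightarrow> dist E x y = 0 \<longleftrightarrow> x = y"
  using dist_le_iff[of x y 0] by auto

lemma dist_commute:
  assumes "x \<in> V" "y \<in> V"
  shows "dist E x y = dist E y x"
proof -
  have "dist E x y \<le> dist E y x" if "x \<in> V" "y \<in> V" for x y
    unfolding dist_le_iff[OF that]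
    by (rule ball_sym[OF symR]) (use dist_le_iff[OF that(2,1)] in blast)
  then show ?thesis using assms by (simp add: le_antisym)
qed

lemma dist_triangle:
  assumes "x \<in> V" "y \<in> V" "z \<in> V"
  shows "dist E x z \<le> dist E x y + dist E y z"
  unfolding dist_le_iff[OF assms(1,3)]
  by (rule ball_trans[where y = y]) (use assms in \<open>simp_all flip: dist_le_iff\<close>)

lemma dist_1_iff:
  assumes "x \<in> V" "y \<in> V"
  shows "dist E x y = 1 \<longleftrightarrow> E x y"
  using dist_le_iff[OF assms, of 1] dist_le_iff[OF assms, of 0] irreflR[of x]
  by auto

lemma dist_edge:
  assumes "E x y" "a \<in> V"
  shows "dist E a y \<le> Suc (dist E a x)"
  using dist_triangle[OF assms(2) E_V[OF assms(1)]] dist_1_iff[OF E_V[OF assms(1)]] assms(1)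
  by simp

lemma closer:
  assumes "a \<in> V" "x \<in> V" "dist E a x = Suc k"
  obtains y where "E x y" "y \<in> V" "dist E a y = k"
proof -
  have "x \<in> ball R (Suc k) {a}" using dist_le_iff[OF assms(1,2), of "Suc k"] assms(3) by simp
  moreover have "x \<notin> ball R k {a}" using dist_le_iff[OF assms(1,2), of k] assms(3) by simp
  ultimately obtain y where y: "y \<in> ball R k {a}" "E y x" by auto
  then have "dist E a y \<le> k" using dist_le_iff[OF assms(1) E_V(1)[OF y(2)]] by simp
  with dist_edge[OF y(2) assms(1)] assms(3) have "dist E a y = k" by simp
  with y(2) show thesis using that E_sym E_V by blast
qed

lemma bag_sub: "t \<in> N \<Longrightarrow> B t \<subseteq> V"
  using td by (simp add: tree_decomp_def)

text \<open>The metric interval between \<open>root\<close> and \<open>a\<close>, the union of all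
  shortest paths. Taking all of them avoids choosing one.\<close>

definition interval :: "'a \<Rightarrow> 'a set" where
  "interval a = {x \<in> V. lev x + dist E x a = lev a}"

lemma interval_root: "a \<in> V \<Longrightarrow> root \<in> interval a"
  using dist_0_iff[OF root root] root by (simp add: interval_def)

lemma interval_self: "a \<in> V \<Longrightarrow> a \<in> interval a"
  using dist_0_iff[of a a] by (simp add: interval_def)

text \<open>A neighbour of \<open>x\<close> one layer lower is at most one step further from
  \<open>a\<close>, and the triangle inequality excludes less than that, so it stays in the
  interval.\<close>

lemma interval_descend:
  assumes a: "a \<in> V" and x: "x \<in> interval a"
  shows "(x, root) \<in> (Restr R (interval a))\<^sup>*"
  using x
proof (induction "lev x" arbitrary: x)
  case 0
  then show ?case using dist_0_iff[OF root, of x] by (auto simp: interval_def)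
next
  case (Suc k)
  have xV: "x \<in> V" using Suc.prems by (simp add: interval_def)
  obtain y where y: "E x y" "y \<in> V" "lev y = k" using closer[OF root xV Suc.hyps(2)[symmetric]] by blast
  have "dist E y a \<le> Suc (dist E x a)"
    using dist_edge[OF y(1) a] dist_commute[OF a] xV y(2) by simp
  moreover have "lev a \<le> lev y + dist E y a" using dist_triangle[OF root y(2) a] .
  ultimately have yI: "y \<in> interval a" using y Suc.hyps(2) Suc.prems by (auto simp: interval_def)
  have "(x, y) \<in> Restr R (interval a)" using y(1) yI Suc.prems by auto
  moreover have "(y, root) \<in> (Restr R (interval a))\<^sup>*" using Suc.hyps(1)[OF _ yI] y(3) by simp
  ultimately show ?case by (rule converse_rtrancl_into_rtrancl)
qed

lemma conn_interval: "a \<in> V \<Longrightarrow> conn_set R (interval a)"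
  unfolding conn_set_def
  using interval_descend sym_rtrancl[OF sym_Restr[OF symR]]
  by (meson rtrancl_trans symD)

text \<open>The connected set and the two geodesics to the root pairwise meet, so one bag hits all three.\<close>

lemma layer_diameter:
  assumes A: "A \<subseteq> V" "conn_set R A" "\<And>x. x \<in> A \<Longrightarrow> r \<le> lev x"
    and ab: "a \<in> A" "b \<in> A" "lev a = r" "lev b = r"
  shows "dist E a b \<le> 3 * \<tau>"
proof -
  have V: "a \<in> V" "b \<in> V" using A ab by auto
  let ?F = "{A, interval a, interval b}"
  have "\<exists>t\<in>N. \<forall>C\<in>?F. C \<inter> B t \<noteq> {}"
  proof (rule bag_hits_bramble[OF td])
    show "C \<subseteq> V \<and> conn_set R C" if "C \<in> ?F" for C
      using that A conn_interval V by (auto simp: interval_def)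
    show "C \<inter> C' \<noteq> {}" if "C \<in> ?F" "C' \<in> ?F" for C C'
      using that V ab interval_self[of a] interval_self[of b] interval_root[of a] interval_root[of b] by auto
  qed
  then obtain t where "t \<in> N" "A \<inter> B t \<noteq> {}" "interval a \<inter> B t \<noteq> {}" "interval b \<inter> B t \<noteq> {}"
    by auto
  then obtain x y z where t: "t \<in> N" "x \<in> A" "x \<in> B t" "y \<in> interval a" "y \<in> B t"
      "z \<in> interval b" "z \<in> B t" by blast
  have VV: "x \<in> V" "y \<in> V" "z \<in> V" using t bag_sub by blast+
  \<comment> \<open>Since \<open>x\<close> is in layer \<open>r\<close> or higher and within
    \<open>\<tau>\<close> of \<open>y\<close> and \<open>z\<close>, these two are at most
    \<open>\<tau>\<close> layers below \<open>r\<close>, hence within \<open>\<tau>\<close> of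
    \<open>a\<close> and \<open>b\<close>.\<close>
  have "lev x \<le> lev y + dist E y x" "lev x \<le> lev z + dist E z x"
    using dist_triangle root VV by auto
  moreover have "dist E y x \<le> \<tau>" "dist E z x \<le> \<tau>" "dist E y z \<le> \<tau>" using bags t by auto
  moreover have "lev y + dist E y a = r" "lev z + dist E z b = r" using t ab by (auto simp: interval_def)
  moreover have "r \<le> lev x" using A t by blast
  ultimately have "dist E y a \<le> \<tau>" "dist E z b \<le> \<tau>" "dist E y z \<le> \<tau>" by linarith+
  moreover have "dist E a b \<le> dist E a y + dist E y b" "dist E y b \<le> dist E y z + dist E z b"
    using dist_triangle V VV by auto
  ultimately show ?thesis using dist_commute[OF V(1) VV(2)] by linarith
qed

section \<open>Sizes of balls and bags in terms of the maximum degree\<close>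

lemma card_ball_dist:
  assumes "A \<subseteq> V" and S: "S \<subseteq> R"
  shows "card (ball S k A) \<le> card A * (maxdeg V E + 1) ^ k"
proof -
  have sub: "S `` {x} \<subseteq> {v. E x v}" for x using S by auto
  have finE: "finite {v. E x v}" for x using fin by (rule finite_subset[rotated]) (use E_V in auto)
  have "card {v. E x v} \<le> maxdeg V E" for x
  proof (cases "x \<in> V")
    case True
    then show ?thesis unfolding maxdeg_def using fin by (intro Max_ge) auto
  next
    case False
    then have "{v. E x v} = {}" using E_V by blast
    then show ?thesis by simp
  qed
  then have deg: "card (S `` {x}) \<le> maxdeg V E" for x
    using card_mono[OF finE sub, of x] by (meson le_trans)
  have "finite (S `` {x})" for x using sub finE by (rule finite_subset)
  moreover have "finite A" using assms(1) fin by (rule finite_subset)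
  ultimately show ?thesis using card_ball_le[of A S "maxdeg V E" k] deg by simp
qed

text \<open>The bag lies in the ball of radius \<open>\<tau>\<close> of the whole graph around any
  of its members.\<close>

lemma card_bag:
  assumes t: "t \<in> N"
  shows "card (B t) \<le> (maxdeg V E + 1) ^ \<tau>"
proof (cases "B t = {}")
  case False
  then obtain x where x: "x \<in> B t" by blast
  then have "B t \<subseteq> ball R \<tau> {x}" using bags[OF t] dist_le_iff bag_sub[OF t] by blast
  moreover have xV: "x \<in> V" using x t bag_sub by blast
  moreover have "finite (ball R \<tau> {x})"
    using ball_subset[OF R_sub, of "{x}"] xV fin finite_subset by blast
  ultimately have "card (B t) \<le> card (ball R \<tau> {x})" by (intro card_mono)
  also have "\<dots> \<le> (maxdeg V E + 1) ^ \<tau>" using card_ball_dist[of "{x}" R \<tau>] xV by simp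
  finally show ?thesis .
qed simp

end

section \<open>Detours around the unexplored part\<close>

text \<open>The situation just before \<open>u\<close> is inserted: all lower layers are explored,
  no higher one is touched, and any part of the layer of \<open>u\<close> may be present.\<close>

locale frontier = tl_graph V E root N TE B \<tau>
  for V :: "'a set" and E root and N :: "'b set" and TE B \<tau> +
  fixes X :: "'a set" and u :: 'a
  assumes X: "X \<subseteq> V" and u: "u \<in> V" "u \<notin> X" and rootX: "root \<in> X"
    and below: "\<And>x. x \<in> V \<Longrightarrow> lev x < lev u \<Longrightarrow> x \<in> X"
    and above: "\<And>x. x \<in> X \<Longrightarrow> lev x \<le> lev u"
begin

abbreviation RX where "RX \<equiv> Restr R X"

text \<open>Descending along a shortest path to \<open>root\<close> enters layers below that of
  \<open>u\<close>, all explored. The last conjunct adds the descent to the connected set needed for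
  \<open>layer_diameter\<close>.\<close>

lemma ancestor:
  assumes "a \<in> X" "lev a = r + k"
  shows "\<exists>a'. lev a' = r \<and> a' \<in> ball RX k {a} \<and> (a, a') \<in> (Restr R {x \<in> V. r \<le> lev x})\<^sup>*"
  using assms
proof (induction k arbitrary: a)
  case (Suc k)
  have aV: "a \<in> V" using Suc.prems X by auto
  obtain y where y: "E a y" "y \<in> V" "lev y = r + k" using closer[OF root aV] Suc.prems by auto
  have yX: "y \<in> X" using below[OF y(2)] above[OF Suc.prems(1)] y(3) Suc.prems(2) by simp
  obtain a' where a': "lev a' = r" "a' \<in> ball RX k {y}" "(y, a') \<in> (Restr R {x \<in> V. r \<le> lev x})\<^sup>*"
    using Suc.IH[OF yX y(3)] by blast
  have "y \<in> ball RX 1 {a}" using y yX Suc.prems by auto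
  then have "a' \<in> ball RX (1 + k) {a}" using a'(2) by (rule ball_trans)
  moreover have "(a, y) \<in> Restr R {x \<in> V. r \<le> lev x}" using y aV Suc.prems by auto
  then have "(a, a') \<in> (Restr R {x \<in> V. r \<le> lev x})\<^sup>*"
    using a'(3) by (rule converse_rtrancl_into_rtrancl)
  ultimately show ?case using a'(1) by auto
qed auto

text \<open>So few steps cannot climb to the layer of \<open>u\<close>, so the hidden and the known
  graph have the same short walks here.\<close>

lemma ball_below:
  assumes "a \<in> V" "lev a + k < lev u"
  shows "ball R k {a} \<subseteq> ball RX k {a} \<and> (\<forall>x\<in>ball R k {a}. x \<in> X \<and> lev x \<le> lev a + k)"
  using assms(2)
proof (induction k)
  case 0
  then show ?case using below assms by auto
next
  case (Suc k)
  have IH: "ball R k {a} \<subseteq> ball RX k {a}" "\<And>x. x \<in> ball R k {a} \<Longrightarrow> x \<in> X \<and> lev x \<le> lev a + k"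
    using Suc by auto
  have new: "y \<in> X \<and> lev y \<le> lev a + Suc k" if "x \<in> ball R k {a}" "E x y" for x y
  proof -
    have "lev y \<le> lev a + Suc k" using dist_edge[OF that(2) root] IH(2)[OF that(1)] by simp
    then show ?thesis using below[OF E_V(2)[OF that(2)]] Suc.prems by simp
  qed
  have "y \<in> ball RX (Suc k) {a}" if "x \<in> ball R k {a}" "E x y" for x y
    using new[OF that] IH(1) IH(2)[OF that(1)] that by auto
  then show ?case using new IH by (auto simp: le_SucI)
qed

text \<open>A walk leaving \<open>X\<close> stays in layers at least that of \<open>u\<close> until it returns; descending \<open>3\<tau>\<close> layers
  below, its ends become close, and the short connection between them has no room to leave \<open>X\<close>.\<close>

lemma reroute:
  assumes a: "a \<in> X" and b: "b \<in> X" and ay: "E a y" and yz: "(y, z) \<in> (Restr R (V - X))\<^sup>*"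
    and zb: "E z b" and y: "y \<notin> X"
  shows "b \<in> ball RX (detour \<tau>) {a}"
proof -
  \<comment> \<open>Layer \<open>lev u - 1\<close> is the last one sure to be explored;
    \<open>3 * \<tau>\<close> steps from layer \<open>r\<close> do not climb past it. If the
    subtraction truncates to \<open>0\<close>, both ancestors are \<open>root\<close>.\<close>
  define r where "r = lev u - 1 - 3 * \<tau>"
  let ?L = "{x \<in> V. r \<le> lev x}"
  define C where "C = {x. (y, x) \<in> (Restr R ?L)\<^sup>*}"
  have out: "lev u \<le> lev x" if "x \<in> V - X" for x using below[of x] that by force
  have yV: "y \<in> V - X" using y E_V ay by blast
  have "lev u \<noteq> 0" using dist_0_iff[OF root u(1)] u(2) rootX by auto
  then have r: "r < lev u" by (auto simp: r_def)
  have zV: "z \<in> V - X"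
    using yz yV by (induction rule: rtrancl_induct) auto
  have "r \<le> lev x" if "x \<in> V - X" for x using out[OF that] r by simp
  then have "Restr R (V - X) \<subseteq> Restr R ?L" by auto
  from rtrancl_mono[OF this] yz have yz_L: "(y, z) \<in> (Restr R ?L)\<^sup>*" by (rule subsetD)
  \<comment> \<open>A neighbour of an unexplored vertex that is itself explored can only be in the
    layer of \<open>u\<close> or the one below.\<close>
  have la: "lev u - 1 \<le> lev a" "lev a \<le> lev u"
    using dist_edge[OF ay root] out[OF yV] above[OF a] by simp_all
  have lb: "lev u - 1 \<le> lev b" "lev b \<le> lev u"
    using dist_edge[OF E_sym[OF zb] root] out[OF zV] above[OF b] by simp_all
  have rad: "lev a - r \<le> 3 * \<tau> + 1" "lev b - r \<le> 3 * \<tau> + 1" using la lb by (auto simp: r_def)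
  have ra: "lev a = r + (lev a - r)" and rb: "lev b = r + (lev b - r)" using la lb by (auto simp: r_def)
  obtain a' where a': "lev a' = r" "a' \<in> ball RX (lev a - r) {a}" "(a, a') \<in> (Restr R ?L)\<^sup>*"
    using ancestor[OF a ra] by blast
  obtain b' where b': "lev b' = r" "b' \<in> ball RX (lev b - r) {b}" "(b, b') \<in> (Restr R ?L)\<^sup>*"
    using ancestor[OF b rb] by blast
  have XV: "a \<in> V" "b \<in> V" using a b X by auto
  have "(y, a) \<in> Restr R ?L" using E_sym[OF ay] XV yV out[OF yV] ra r by auto
  then have "(y, a') \<in> (Restr R ?L)\<^sup>*" using a'(3) by (rule converse_rtrancl_into_rtrancl)
  then have aC: "a' \<in> C" by (simp add: C_def)
  have "(z, b) \<in> Restr R ?L" using zb XV zV out[OF zV] rb r by auto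
  then have "(z, b') \<in> (Restr R ?L)\<^sup>*" using b'(3) by (rule converse_rtrancl_into_rtrancl)
  with yz_L have "(y, b') \<in> (Restr R ?L)\<^sup>*" by (rule rtrancl_trans)
  then have bC: "b' \<in> C" by (simp add: C_def)
  have CL: "C \<subseteq> ?L"
  proof
    fix x assume "x \<in> C"
    then have "(y, x) \<in> (Restr R ?L)\<^sup>*" by (simp add: C_def)
    then show "x \<in> ?L" by (induction rule: rtrancl_induct) (use yV out[OF yV] r in auto)
  qed
  have "conn_set R C" unfolding C_def using symR by (rule conn_set_reachable)
  then have d: "dist E a' b' \<le> 3 * \<tau>" using CL aC bC a'(1) b'(1) by (intro layer_diameter[of C r]) auto
  have V': "a' \<in> V" "b' \<in> V" using aC bC CL by auto
  have "b' \<in> ball RX (3 * \<tau>) {a'}"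
  proof (cases "r = 0")
    case True
    then have "a' = root" "b' = root" using a'(1) b'(1) dist_0_iff[OF root] V' by auto
    then show ?thesis using ball_center[of "{root}" RX "3 * \<tau>"] by auto
  next
    case False
    then have "lev a' + 3 * \<tau> < lev u" using a'(1) r by (auto simp: r_def)
    from ball_below[OF V'(1) this] show ?thesis using d unfolding dist_le_iff[OF V'] by (auto dest: subsetD)
  qed
  with a'(2) have "b' \<in> ball RX (lev a - r + 3 * \<tau>) {a}" by (rule ball_trans)
  moreover have "b \<in> ball RX (lev b - r) {b'}" using ball_sym[OF sym_Restr[OF symR] b'(2)] .
  ultimately have "b \<in> ball RX (lev a - r + 3 * \<tau> + (lev b - r)) {a}" by (rule ball_trans)
  moreover have "lev a - r + 3 * \<tau> + (lev b - r) \<le> detour \<tau>" using rad by (simp add: detour_def)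
  ultimately show ?thesis by (rule subsetD[OF ball_mono_rad, rotated])
qed

text \<open>The witness is the first vertex of \<open>X\<close> after \<open>z\<close> on a shortest path from \<open>z\<close> to \<open>u\<close> and on to \<open>p\<close>.\<close>

lemma closer_in_X:
  assumes z: "z \<in> X" and far: "dist E u z > 1" and p: "E u p" "p \<in> X"
  obtains b where "b \<in> X" "dist E u b < dist E u z" "b \<in> ball RX (detour \<tau>) {z}"
proof -
  have zV: "z \<in> V" using z X by auto
  obtain y where y: "E z y" "y \<in> V" "dist E u y = dist E u z - 1"
    using closer[OF u(1) zV, of "dist E u z - 1"] far by auto
  have exit: "\<exists>b. b \<in> X \<and> dist E u b < dist E u z \<and> b \<in> ball RX (detour \<tau>) {z}"
    if "(y, q) \<in> (Restr R (V - X))\<^sup>*" "q \<in> V - X" "dist E u q < dist E u z" "y \<notin> X" for q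
    using that
  proof (induction "dist E u q" arbitrary: q)
    \<comment> \<open>The shortest path reached \<open>u\<close> without entering \<open>X\<close>.
      Then \<open>p\<close> is the witness, being at distance 1 while \<open>far\<close> puts
      \<open>z\<close> further away.\<close>
    case 0
    then have "q = u" using dist_0_iff[OF u(1), of q] by auto
    then have "p \<in> ball RX (detour \<tau>) {z}"
      using reroute[OF z p(2) y(1) _ _ 0(5), of u] 0(2) p(1) by simp
    moreover have "dist E u p = 1" using dist_1_iff[of u p] p(1) E_V[OF p(1)] by simp
    ultimately show ?case using far p(2) by (intro exI[of _ p]) simp
  next
    case (Suc k)
    have "q \<in> V" using Suc.prems(2) by simp
    from closer[OF u(1) this Suc.hyps(2)[symmetric]]
    obtain w where w: "E q w" "w \<in> V" "dist E u w = k" by blast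
    show ?case
    proof (cases "w \<in> X")
      case True
      have "w \<in> ball RX (detour \<tau>) {z}"
        by (rule reroute[OF z True y(1) Suc.prems(1) w(1) Suc.prems(4)])
      moreover have "dist E u w < dist E u z" using w(3) Suc.hyps(2) Suc.prems(3) by simp
      ultimately show ?thesis using True by (intro exI[of _ w]) simp
    next
      case False
      have "(q, w) \<in> Restr R (V - X)" using w(1,2) False Suc.prems(2) by simp
      with Suc.prems(1) have "(y, w) \<in> (Restr R (V - X))\<^sup>*" by (rule rtrancl_into_rtrancl)
      then show ?thesis using Suc.hyps(1)[of w] w False Suc.hyps(2) Suc.prems(3,4) by simp
    qed
  qed
  show thesis
  proof (cases "y \<in> X")
    case True
    have "y \<in> ball RX 1 {z}" using y(1) z True by simp
    then have "y \<in> ball RX (detour \<tau>) {z}" 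
      by (rule subsetD[OF ball_mono_rad, rotated]) (simp add: detour_def)
    moreover have "dist E u y < dist E u z" using y(3) far by simp
    ultimately show thesis by (intro that[OF True])
  next
    case False
    then have "\<exists>b. b \<in> X \<and> dist E u b < dist E u z \<and> b \<in> ball RX (detour \<tau>) {z}"
      using exit[of y] y(2,3) far by simp
    then show thesis using that by (elim exE conjE)
  qed
qed

text \<open>Every excursion of the walk outside \<open>X\<close> is replaced by a detour too short to reach \<open>S\<close>.\<close>

lemma avoid_separator:
  assumes "(z, p) \<in> (Restr R (- ball RX (detour \<tau>) S))\<^sup>*"
    and z: "z \<in> X" "z \<notin> ball RX (detour \<tau>) S" and p: "p \<in> X"
  shows "(z, p) \<in> (Restr RX (X - S))\<^sup>*"
proof -
  let ?D = "ball RX (detour \<tau>) S" and ?T = "Restr RX (X - S)"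
  \<comment> \<open>Invariant: \<open>a\<close> is the last vertex of \<open>X\<close> visited. The
    walk is either still at \<open>a\<close> or on an excursion that left \<open>X\<close> from
    \<open>a\<close> through \<open>y\<close>.\<close>
  have "\<exists>a\<in>X - ?D. (z, a) \<in> ?T\<^sup>* \<and>
     (q = a \<or> (q \<notin> X \<and> (\<exists>y. E a y \<and> y \<notin> X \<and> (y, q) \<in> (Restr R (V - X))\<^sup>*)))"
    if "(z, q) \<in> (Restr R (- ?D))\<^sup>*" for q
    using that
  proof (induction rule: rtrancl_induct)
    case base
    then show ?case using z by blast
  next
    case (step q w)
    then obtain a where a: "a \<in> X" "a \<notin> ?D" "(z, a) \<in> ?T\<^sup>*"
      and q: "q = a \<or> (q \<notin> X \<and> (\<exists>y. E a y \<and> y \<notin> X \<and> (y, q) \<in> (Restr R (V - X))\<^sup>*))" by blast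
    have qw: "E q w" "w \<notin> ?D" using step.hyps by auto
    have SD: "S \<subseteq> ?D" by (rule ball_center)
    consider (in_in) "q = a" "w \<in> X" | (in_out) "q = a" "w \<notin> X"
      | y where "q \<notin> X" "E a y" "y \<notin> X" "(y, q) \<in> (Restr R (V - X))\<^sup>*" using q by blast
    then show ?case
    proof cases
      case in_in
      then have "(a, w) \<in> ?T" using qw a SD by auto
      with a(3) have "(z, w) \<in> ?T\<^sup>*" by (rule rtrancl_into_rtrancl)
      then show ?thesis using in_in qw by blast
    next
      case in_out
      then show ?thesis using a qw by blast
    next
      case 3
      show ?thesis
      proof (cases "w \<in> X")
        case True
        have "w \<in> ball RX (detour \<tau>) {a}" using reroute[OF a(1) True 3(2,4) qw(1) 3(3)] .
        then have "(a, w) \<in> (Restr RX (- S))\<^sup>*" 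
          by (rule ball_avoiding[OF sym_Restr[OF symR] _ a(2)])
        moreover have "Restr RX (- S) = ?T" by auto
        ultimately have "(z, w) \<in> ?T\<^sup>*" using a(3) by (metis rtrancl_trans)
        then show ?thesis using True qw by blast
      next
        case False
        then have "(q, w) \<in> Restr R (V - X)" using qw 3 E_V by auto
        with 3(4) have "(y, w) \<in> (Restr R (V - X))\<^sup>*" by (rule rtrancl_into_rtrancl)
        then show ?thesis using a 3 False by blast
      qed
    qed
  qed
  from this[OF assms(1)] show ?thesis using p by blast
qed

text \<open>A shortest path from \<open>z\<close> to \<open>u\<close> avoids the thickened separator, since each later vertex is
  closer to \<open>u\<close> than all of \<open>Z\<close>.\<close>

lemma nearest_component:
  assumes S: "S \<subseteq> X" and Z: "Z = ball RX (2 * detour \<tau>) S"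
    and z: "z \<in> Z" and nearest: "\<And>x. x \<in> Z \<Longrightarrow> dist E u z \<le> dist E u x"
    and far: "dist E u z > 1" and p: "E u p" "p \<in> X"
  shows "(z, p) \<in> (Restr RX (X - S))\<^sup>*"
proof -
  let ?D = "ball RX (detour \<tau>) S"
  have DZ: "?D \<subseteq> Z" unfolding Z by (rule ball_mono_rad) simp
  have "RX \<subseteq> X \<times> X" by blast
  from ball_subset[OF this S] have zX: "z \<in> X" using z unfolding Z by (rule subsetD)
  have zD: "z \<notin> ?D"
  \<comment> \<open>This is why \<open>Z\<close> has twice the radius: from a \<open>z\<close>
    within \<open>detour \<tau>\<close> of \<open>S\<close>, the closer vertex one detour away would
    still be in \<open>Z\<close>.\<close>
  proof
    assume zD: "z \<in> ?D"
    obtain b where b: "dist E u b < dist E u z" "b \<in> ball RX (detour \<tau>) {z}"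
      using closer_in_X[OF zX far p] by blast
    have "b \<in> Z" unfolding Z using ball_trans[OF zD b(2)] by (simp add: mult_2)
    then show False using nearest b(1) by fastforce
  qed
  have notD: "x \<notin> ?D" if "dist E u x < dist E u z" for x
    using nearest DZ that by fastforce
  have "(q, u) \<in> (Restr R (- ?D))\<^sup>*" if "q \<in> V" "q = z \<or> dist E u q < dist E u z" for q
    using that
  proof (induction "dist E u q" arbitrary: q)
    case 0
    then have "q = u" using dist_0_iff[OF u(1)] by auto
    then show ?case by simp
  next
    case (Suc k)
    obtain w where w: "E q w" "w \<in> V" "dist E u w = k"
      using closer[OF u(1) Suc.prems(1) Suc.hyps(2)[symmetric]] by blast
    have lt: "dist E u w < dist E u z" using w Suc by auto
    have "(q, w) \<in> Restr R (- ?D)" using w(1) notD[OF lt] zD notD Suc.prems(2) by auto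
    moreover have "(w, u) \<in> (Restr R (- ?D))\<^sup>*" using Suc.hyps(1) w lt by blast
    ultimately show ?case by (rule converse_rtrancl_into_rtrancl)
  qed
  then have "(z, u) \<in> (Restr R (- ?D))\<^sup>*" using zX X by blast
  moreover have "(u, p) \<in> Restr R (- ?D)"
  proof -
    have "dist E u p = 1" "dist E u u = 0" using dist_1_iff dist_0_iff u p E_V by blast+
    then have "p \<notin> ?D" "u \<notin> ?D" using notD[of p] notD[of u] far by auto
    then show ?thesis using p by auto
  qed
  ultimately have "(z, p) \<in> (Restr R (- ?D))\<^sup>*" by (rule rtrancl_into_rtrancl)
  then show ?thesis using avoid_separator[OF _ zX zD p(2)] by blast
qed

text \<open>The walk from \<open>p\<close> over \<open>u\<close> to \<open>q\<close> is an excursion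
  outside \<open>X\<close> consisting of \<open>u\<close> alone.\<close>

lemma neighbours_close:
  assumes "E u p" "p \<in> X" "E u q" "q \<in> X"
  shows "q \<in> ball RX (detour \<tau>) {p}"
  by (rule reroute[of p q u u]) (use assms E_sym u in auto)

lemma parent:
  obtains p where "p \<in> X" "E u p"
proof -
  have "lev u \<noteq> 0" using dist_0_iff[OF root u(1)] u(2) rootX by auto
  then obtain k where k: "lev u = Suc k" using not0_implies_Suc by blast
  obtain p where "E u p" "p \<in> V" "lev p = k" using closer[OF root u(1) k] by blast
  then show thesis using that below k by auto
qed

text \<open>The connected subsets of \<open>X\<close> holding more than half of \<open>W\<close> form a bramble.\<close>

lemma balanced_separator:
  assumes W: "W \<subseteq> X"
  obtains S where "S \<subseteq> X" "root \<in> S" "card S \<le> (maxdeg V E + 1) ^ \<tau> + 1"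
    "\<And>C. C \<subseteq> X - S \<Longrightarrow> conn_set RX C \<Longrightarrow> 2 * card (C \<inter> W) \<le> card W"
proof -
  define F where "F = {C. C \<subseteq> X \<and> conn_set RX C \<and> card W < 2 * card (C \<inter> W)}"
  have finW: "finite W" using W X fin by (meson finite_subset)
  have "\<exists>t\<in>N. \<forall>C\<in>F. C \<inter> B t \<noteq> {}"
  proof (rule bag_hits_bramble[OF td])
    show "C \<subseteq> V \<and> conn_set R C" if C: "C \<in> F" for C
    proof -
      have "Restr RX C = Restr R C" using C by (auto simp: F_def)
      then show ?thesis using C X by (auto simp: F_def conn_set_def)
    qed
    show "C \<inter> C' \<noteq> {}" if C: "C \<in> F" "C' \<in> F" for C C'
    proof
      assume "C \<inter> C' = {}"
      then have "card (C \<inter> W) + card (C' \<inter> W) = card ((C \<inter> W) \<union> (C' \<inter> W))"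
        using finW by (intro card_Un_disjoint[symmetric]) auto
      also have "\<dots> \<le> card W" using finW by (intro card_mono) auto
      finally show False using C by (auto simp: F_def)
    qed
  qed
  then obtain t where t: "t \<in> N" "\<And>C. C \<in> F \<Longrightarrow> C \<inter> B t \<noteq> {}" by blast
  \<comment> \<open>Members of \<open>F\<close> lie in \<open>X\<close>, so the explored part of the
    bag still meets them all. The root accounts for the summand 1 in the bound.\<close>
  let ?S = "insert root (B t \<inter> X)"
  have "finite (B t)" using bag_sub[OF t(1)] fin finite_subset by blast
  then have "card (B t \<inter> X) \<le> card (B t)" by (intro card_mono) auto
  moreover have "card ?S \<le> Suc (card (B t \<inter> X))" by (simp add: card_insert_if \<open>finite (B t)\<close>)
  ultimately have "card ?S \<le> (maxdeg V E + 1) ^ \<tau> + 1" using card_bag[OF t(1)] by simp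
  moreover have "2 * card (C \<inter> W) \<le> card W" if "C \<subseteq> X - ?S" "conn_set RX C" for C
    using t(2)[of C] that by (auto simp: F_def not_less[symmetric])
  ultimately show thesis using that[of ?S] rootX by blast
qed

end

section \<open>The query strategy\<close>

text \<open>Continuation-passing style makes up for the absence of sequencing in
  \<open>qtree\<close>: \<open>c\<close> receives the table of answers, which is \<open>0\<close>
  off the list.\<close>

primrec ask_list :: "nat \<Rightarrow> nat list \<Rightarrow> ((nat \<Rightarrow> nat) \<Rightarrow> qtree) \<Rightarrow> qtree" where
  "ask_list u [] c = c (\<lambda>_. 0)"
| "ask_list u (x # xs) c = Query u x (\<lambda>a. ask_list u xs (\<lambda>g. c (g(x := a))))"

definition ask :: "nat \<Rightarrow> nat set \<Rightarrow> ((nat \<Rightarrow> nat) \<Rightarrow> qtree) \<Rightarrow> qtree" where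
  "ask u A = ask_list u (sorted_list_of_set A)"

lemma run_ask_list:
  "run (ask_list u xs c) d =
    (let r = run (c (\<lambda>x. if x \<in> set xs then d u x else 0)) d in (fst r, snd r + length xs))"
proof (induction xs arbitrary: c)
  case (Cons y xs)
  have "(\<lambda>x. if x \<in> set xs then d u x else 0)(y := d u y) =
      (\<lambda>x. if x \<in> set (y # xs) then d u x else 0)" by auto
  then show ?case by (simp add: Cons.IH Let_def)
qed simp

lemma run_ask:
  assumes "finite A"
  shows "run (ask u A c) d =
    (let r = run (c (\<lambda>x. if x \<in> A then d u x else 0)) d in (fst r, snd r + card A))"
  using assms by (simp add: ask_def run_ask_list)

text \<open>Requiring the root to lie in \<open>S\<close> only serves to make the set of queried vertices nonempty.\<close>

definition separates :: "(nat \<times> nat) set \<Rightarrow> nat set \<Rightarrow> nat set \<Rightarrow> nat set \<Rightarrow> bool" where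
  "separates F X W S \<longleftrightarrow> S \<subseteq> X \<and> 0 \<in> S \<and>
    (\<forall>C\<subseteq>X - S. conn_set F C \<longrightarrow> 2 * card (C \<inter> W) \<le> card W)"

text \<open>Computed from known edges without queries. Minimality gives the size bound of
  \<open>balanced_separator\<close> although the algorithm is not told the maximum degree.\<close>

definition separator :: "(nat \<times> nat) set \<Rightarrow> nat set \<Rightarrow> nat set \<Rightarrow> nat set" where
  "separator F X W = arg_min card (separates F X W)"

text \<open>Searches for a neighbour of \<open>u\<close> in the explored part \<open>X\<close>, where \<open>W\<close> contains all such neighbours.
  The value \<open>0\<close> returned when the fuel is exhausted is junk and never reached.\<close>

primrec locate ::
  "nat \<Rightarrow> (nat \<times> nat) set \<Rightarrow> nat set \<Rightarrow> nat \<Rightarrow> nat \<Rightarrow> nat set \<Rightarrow> (nat \<Rightarrow> qtree) \<Rightarrow> qtree" where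
  "locate \<tau> F X u 0 W c = c 0"
| "locate \<tau> F X u (Suc k) W c =
    (let S = separator F X W; Z = ball F (2 * detour \<tau>) S in
     ask u Z (\<lambda>g. let z = arg_min_on g Z in
       if g z \<le> 1 then c z
       else locate \<tau> F X u k {w \<in> W. (z, w) \<in> (Restr F (X - S))\<^sup>*} c))"

definition attach ::
  "nat \<Rightarrow> nat \<Rightarrow> nat set \<Rightarrow> (nat \<times> nat) set \<Rightarrow> nat \<Rightarrow> ((nat \<times> nat) set \<Rightarrow> qtree) \<Rightarrow> qtree" where
  "attach \<tau> n X F u c = locate \<tau> F X u n X (\<lambda>p.
     let Y = ball F (detour \<tau>) {p} in
     ask u Y (\<lambda>g. let A = {v \<in> Y. g v = 1} in c (F \<union> {u} \<times> A \<union> A \<times> {u})))"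

primrec build :: "nat \<Rightarrow> nat \<Rightarrow> nat list \<Rightarrow> nat set \<Rightarrow> (nat \<times> nat) set \<Rightarrow> qtree" where
  "build \<tau> n [] X F = Output F"
| "build \<tau> n (u # us) X F = attach \<tau> n X F u (build \<tau> n us (insert u X))"

text \<open>The first \<open>n\<close> queries reveal the layers. Vertex \<open>0\<close> is absent
  from the sorted list because it is the initial explored set.\<close>

definition reconstruct :: "nat \<Rightarrow> nat \<Rightarrow> qtree" where
  "reconstruct n \<tau> = ask 0 {0..<n} (\<lambda>g. build \<tau> n (sort_key g [1..<n]) {0} {})"

section \<open>Correctness and query counts of the strategy\<close>

definition separator_cost :: "nat \<Rightarrow> nat \<Rightarrow> nat" where
  "separator_cost D \<tau> = ((D + 1) ^ \<tau> + 1) * (D + 1) ^ (2 * detour \<tau>)"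

text \<open>Each round at least halves \<open>W\<close>, so \<open>k\<close> rounds suffice,
  whatever the fuel above \<open>k\<close>. The vertex and the count are chosen before
  \<open>c\<close>, which lets the runs be composed.\<close>

lemma run_locate:
  assumes "frontier V E 0 N TE B \<tau> X u"
    and "W \<subseteq> X" "\<And>p. p \<in> X \<Longrightarrow> E u p \<Longrightarrow> p \<in> W" "card W < 2 ^ k" "k \<le> fuel"
  shows "\<exists>z m. z \<in> X \<and> E u z \<and> m \<le> k * separator_cost (maxdeg V E) \<tau> \<and>
    (\<forall>c. run (locate \<tau> (Restr {(x, y). E x y} X) X u fuel W c) (dist E) =
      (fst (run (c z) (dist E)), snd (run (c z) (dist E)) + m))"
  using assms(2-)
proof (induction fuel arbitrary: W k)
  case 0
  interpret frontier V E 0 N TE B \<tau> X u by fact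
  have "finite W" using 0(1) X fin by (meson finite_subset)
  \<comment> \<open>Running out of fuel would leave no candidates, yet \<open>u\<close> has a
    neighbour in \<open>X\<close>.\<close>
  then have "W = {}" using 0(3,4) by simp
  moreover obtain p where "p \<in> X" "E u p" by (rule parent)
  ultimately show ?case using 0(2)[of p] by simp
next
  case (Suc fuel)
  interpret frontier V E 0 N TE B \<tau> X u by fact
  let ?Q = "separator_cost (maxdeg V E) \<tau>"
  have finW: "finite W" using Suc.prems(1) X fin by (meson finite_subset)
  obtain p where p: "p \<in> X" "E u p" using parent by blast
  have "p \<in> W" using p Suc.prems(2) by blast
  then have "k \<noteq> 0" using Suc.prems(3) finW by (cases k) auto
  then obtain k' where k: "k = Suc k'" by (cases k) auto
  define S where "S = separator RX X W"
  obtain S0 where S0: "S0 \<subseteq> X" "0 \<in> S0" "card S0 \<le> (maxdeg V E + 1) ^ \<tau> + 1"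
    "\<And>C. C \<subseteq> X - S0 \<Longrightarrow> conn_set RX C \<Longrightarrow> 2 * card (C \<inter> W) \<le> card W"
    using balanced_separator[OF Suc.prems(1)] by blast
  have sep0: "separates RX X W S0" using S0 by (simp add: separates_def)
  have sep: "separates RX X W S"
    unfolding S_def separator_def using sep0 by (rule arg_min_natI)
  have "card S \<le> card S0"
    unfolding S_def separator_def using sep0 by (rule arg_min_nat_le)
  with S0(3) have cardS: "card S \<le> (maxdeg V E + 1) ^ \<tau> + 1" by simp
  have SX: "S \<subseteq> X" "0 \<in> S" using sep by (auto simp: separates_def)
  have RX_sub: "RX \<subseteq> X \<times> X" by blast
  define Z where "Z = ball RX (2 * detour \<tau>) S"
  define g where "g = (\<lambda>x. if x \<in> Z then dist E u x else 0)"
  define z where "z = arg_min_on g Z"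
  have ZX: "Z \<subseteq> X" unfolding Z_def using RX_sub SX(1) by (rule ball_subset)
  have finZ: "finite Z" using ZX X fin by (meson finite_subset)
  have "0 \<in> Z" using ball_center[of S RX] SX(2) unfolding Z_def by (rule subsetD)
  then have neZ: "Z \<noteq> {}" by blast
  have zZ: "z \<in> Z" unfolding z_def using finZ neZ by (rule arg_min_if_finite(1))
  have "g z \<le> g x" if "x \<in> Z" for x
    unfolding z_def using finZ neZ that by (rule arg_min_least)
  then have nearest: "dist E u z \<le> dist E u x" if "x \<in> Z" for x
    using that zZ by (auto simp: g_def)
  have gz: "g z = dist E u z" using zZ by (simp add: g_def)
  have zX: "z \<in> X" using zZ ZX by (rule subsetD[rotated])
  have "S \<subseteq> V" using SX(1) X by (rule subset_trans)
  then have "card Z \<le> card S * (maxdeg V E + 1) ^ (2 * detour \<tau>)"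
    unfolding Z_def by (intro card_ball_dist) auto
  also have "\<dots> \<le> ?Q" unfolding separator_cost_def using cardS by (rule mult_right_mono) simp
  finally have cardZ: "card Z \<le> ?Q" .
  let ?C = "{x. (z, x) \<in> (Restr RX (X - S))\<^sup>*}"
  define W' where "W' = {w \<in> W. (z, w) \<in> (Restr RX (X - S))\<^sup>*}"
  have run_Suc: "run (locate \<tau> RX X u (Suc fuel) W c) (dist E) =
      (let r = run (if dist E u z \<le> 1 then c z else locate \<tau> RX X u fuel W' c) (dist E)
       in (fst r, snd r + card Z))" for c
    unfolding locate.simps S_def[symmetric] Let_def Z_def[symmetric] run_ask[OF finZ]
      g_def[symmetric] z_def[symmetric] W'_def[symmetric] by (simp add: gz zZ)
  show ?case
  proof (cases "dist E u z \<le> 1")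
    case True
    have "u \<noteq> z" using zX u(2) by blast
    then have "dist E u z \<noteq> 0" using dist_0_iff[OF u(1), of z] zX X by auto
    then have "E u z" using True dist_1_iff[OF u(1), of z] zX X by auto
    moreover have "card Z \<le> k * ?Q" using cardZ k by simp
    ultimately show ?thesis using zX True
      by - (rule exI[of _ z], rule exI[of _ "card Z"], simp add: run_Suc Let_def del: locate.simps)
  next
    case False
    have comp: "(z, q) \<in> (Restr RX (X - S))\<^sup>*" if "q \<in> X" "E u q" for q
      by (rule nearest_component[OF SX(1) Z_def zZ nearest _ that(2,1)]) (use False in auto)
    have "dist E u p = 1" using dist_1_iff[of u p] p E_V by blast
    then have "z \<noteq> p" using False by auto
    \<comment> \<open>A walk inside \<open>X - S\<close> between distinct vertices has a first edge,
      whose start \<open>z\<close> is then in \<open>X - S\<close>.\<close>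
    with comp[OF p] have zXS: "z \<in> X - S" by (auto elim: converse_rtranclE)
    have "?C \<subseteq> X - S"
    proof
      fix x assume "x \<in> ?C"
      then have "(z, x) \<in> (Restr RX (X - S))\<^sup>*" by simp
      then show "x \<in> X - S" by (induction rule: rtrancl_induct) (use zXS in auto)
    qed
    moreover have "conn_set RX ?C" by (rule conn_set_reachable[OF sym_Restr[OF symR]])
    ultimately have "2 * card (?C \<inter> W) \<le> card W" using sep by (simp add: separates_def)
    moreover have "?C \<inter> W = W'" by (auto simp: W'_def)
    ultimately have "card W' < 2 ^ k'" using Suc.prems(3) k by simp
    moreover have "W' \<subseteq> X" using Suc.prems(1) by (auto simp: W'_def)
    moreover have "q \<in> W'" if "q \<in> X" "E u q" for q
      using comp[OF that] Suc.prems(2)[OF that] by (simp add: W'_def)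
    moreover have "k' \<le> fuel" using Suc.prems(4) k by simp
    ultimately obtain y m where y: "y \<in> X" "E u y" "m \<le> k' * ?Q"
      "\<And>c. run (locate \<tau> RX X u fuel W' c) (dist E) =
        (fst (run (c y) (dist E)), snd (run (c y) (dist E)) + m)"
      using Suc.IH[of W' k'] by blast
    have "m + card Z \<le> k * ?Q" using y(3) cardZ k by simp
    then show ?thesis using y False
      by - (rule exI[of _ y], rule exI[of _ "m + card Z"],
        simp add: run_Suc Let_def del: locate.simps)
  qed
qed

definition attach_cost :: "nat \<Rightarrow> nat \<Rightarrow> nat \<Rightarrow> nat" where
  "attach_cost D \<tau> k = k * separator_cost D \<tau> + (D + 1) ^ detour \<tau>"

text \<open>Asking the whole ball around one neighbour reveals all edges from \<open>u\<close> to
  \<open>X\<close>, so the known relation is again the induced one.\<close>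

lemma run_attach:
  assumes "frontier V E 0 N TE B \<tau> X u" and n: "card X < 2 ^ k" "k \<le> n"
  shows "\<exists>m \<le> attach_cost (maxdeg V E) \<tau> k. \<forall>c.
    run (attach \<tau> n X (Restr {(x, y). E x y} X) u c) (dist E) =
      (let r = run (c (Restr {(x, y). E x y} (insert u X))) (dist E) in (fst r, snd r + m))"
proof -
  interpret frontier V E 0 N TE B \<tau> X u by fact
  obtain p m where p: "p \<in> X" "E u p" "m \<le> k * separator_cost (maxdeg V E) \<tau>"
    and run_p: "\<And>c. run (locate \<tau> RX X u n X c) (dist E) =
      (fst (run (c p) (dist E)), snd (run (c p) (dist E)) + m)"
    using run_locate[OF assms(1) order_refl _ n] by blast
  define Y where "Y = ball RX (detour \<tau>) {p}"
  have "RX \<subseteq> X \<times> X" by blast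
  then have YX: "Y \<subseteq> X" unfolding Y_def by (rule ball_subset) (use p(1) in simp)
  have finY: "finite Y" using YX X fin by (meson finite_subset)
  have nb: "q \<in> Y" if "q \<in> X" "E u q" for q
    unfolding Y_def by (rule neighbours_close[OF p(2,1) that(2,1)])
  have "{p} \<subseteq> V" using p(1) X by auto
  then have cardY: "card Y \<le> (maxdeg V E + 1) ^ detour \<tau>"
    unfolding Y_def using card_ball_dist[of "{p}" RX "detour \<tau>"] by auto
  define A where "A = {v \<in> Y. (if v \<in> Y then dist E u v else 0) = 1}"
  have "A = {v \<in> X. E u v}"
    using YX X nb dist_1_iff[OF u(1)] by (fastforce simp: A_def)
  then have edges: "RX \<union> {u} \<times> A \<union> A \<times> {u} = Restr R (insert u X)"
    using u(2) irreflR E_sym by auto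
  have "run (attach \<tau> n X RX u c) (dist E) =
      (let r = run (c (Restr R (insert u X))) (dist E) in (fst r, snd r + (card Y + m)))" for c
    unfolding attach_def run_p Let_def Y_def[symmetric] run_ask[OF finY] A_def[symmetric] edges by simp
  then show ?thesis using p(3) cardY unfolding attach_cost_def
    by (intro exI[of _ "card Y + m"]) simp
qed

text \<open>Sortedness by layer provides the \<open>frontier\<close> conditions at each
  insertion.\<close>

lemma run_build:
  assumes "tl_graph V E 0 N TE B \<tau>" and n: "card V < 2 ^ k" "k \<le> n"
    and "X \<union> set us = V" "X \<inter> set us = {}" "distinct us" "0 \<in> X"
    and "sorted (map (dist E 0) us)" "\<And>x y. x \<in> X \<Longrightarrow> y \<in> set us \<Longrightarrow> dist E 0 x \<le> dist E 0 y"
  shows "fst (run (build \<tau> n us X (Restr {(x, y). E x y} X)) (dist E)) = {(x, y). E x y} \<and>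
    snd (run (build \<tau> n us X (Restr {(x, y). E x y} X)) (dist E))
      \<le> length us * attach_cost (maxdeg V E) \<tau> k"
  using assms(4-)
proof (induction us arbitrary: X)
  case Nil
  interpret tl_graph V E 0 N TE B \<tau> by fact
  show ?case using Nil R_sub by auto
next
  case (Cons u us)
  interpret tl_graph V E 0 N TE B \<tau> by fact
  have fr: "frontier V E 0 N TE B \<tau> X u"
  proof unfold_locales
    show "X \<subseteq> V" "u \<in> V" "u \<notin> X" "0 \<in> X" using Cons.prems by auto
    show "x \<in> X" if "x \<in> V" "lev x < lev u" for x
    proof (rule ccontr)
      assume "x \<notin> X"
      then have "x \<in> set (u # us)" using that(1) Cons.prems(1) by blast
      then have "lev u \<le> lev x" using Cons.prems(5) by auto
      with that(2) show False by simp
    qed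
    show "lev x \<le> lev u" if "x \<in> X" for x using Cons.prems(6)[OF that] by simp
  qed
  have "card X \<le> card V" using fin Cons.prems(1) by (intro card_mono) auto
  with n have "card X < 2 ^ k" by simp
  from run_attach[OF fr this n(2)] obtain m where m: "m \<le> attach_cost (maxdeg V E) \<tau> k"
    "\<And>c. run (attach \<tau> n X (Restr R X) u c) (dist E) =
      (let r = run (c (Restr R (insert u X))) (dist E) in (fst r, snd r + m))" by blast
  have IH: "fst (run (build \<tau> n us (insert u X) (Restr R (insert u X))) (dist E)) = R \<and>
    snd (run (build \<tau> n us (insert u X) (Restr R (insert u X))) (dist E))
      \<le> length us * attach_cost (maxdeg V E) \<tau> k"
  proof (rule Cons.IH)
    show "insert u X \<union> set us = V" "insert u X \<inter> set us = {}" "distinct us" "0 \<in> insert u X"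
      "sorted (map lev us)" using Cons.prems by auto
    show "lev x \<le> lev y" if "x \<in> insert u X" "y \<in> set us" for x y
      using that Cons.prems(5,6) by auto
  qed
  then show ?case using m by (simp add: Let_def)
qed

text \<open>The decomposition with the single bag \<open>V\<close> shows that the
  \<open>LEAST\<close> ranges over a nonempty set.\<close>

lemma treelength_attained:
  assumes "graph_on V E" "finite V"
  shows "\<exists>(N :: nat set) TE B. tree_decomp V E N TE B \<and>
    (\<forall>t\<in>N. \<forall>x\<in>B t. \<forall>y\<in>B t. dist E x y \<le> treelength V E)"
proof -
  let ?l = "Max ((\<lambda>(x, y). dist E x y) ` (V \<times> V))"
  have single: "connected_on {0 :: nat} T" for T
    unfolding connected_on_def by (auto simp: walk_def intro!: exI[of _ "[0]"])
  have "is_tree {0 :: nat} (\<lambda>_ _. False)"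
    using single by (auto simp: is_tree_def graph_on_def)
  moreover have "connected_on {t \<in> {0 :: nat}. v \<in> V} (\<lambda>s t. False \<and> v \<in> V \<and> v \<in> V)" if "v \<in> V" for v
    using single that by simp
  ultimately have "tree_decomp V E {0 :: nat} (\<lambda>_ _. False) (\<lambda>_. V)"
    using assms(1) by (auto simp: tree_decomp_def graph_on_def)
  moreover have "dist E x y \<le> ?l" if "x \<in> V" "y \<in> V" for x y
    using assms that by (intro Max_ge) auto
  ultimately have "\<exists>l. \<exists>(N :: nat set) TE B. tree_decomp V E N TE B \<and>
    (\<forall>t\<in>N. \<forall>x\<in>B t. \<forall>y\<in>B t. dist E x y \<le> l)"
    by (intro exI[of _ ?l] exI[of _ "{0}"] exI[of _ "\<lambda>_ _. False"] exI[of _ "\<lambda>_. V"]) auto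
  then show ?thesis unfolding treelength_def by (rule LeastI_ex)
qed

lemma run_reconstruct:
  assumes "tl_graph {0..<n} E 0 N TE B \<tau>" and k: "n < 2 ^ k" "k \<le> n" and n: "n \<ge> 2"
  shows "fst (run (reconstruct n \<tau>) (dist E)) = {(x, y). E x y} \<and>
    snd (run (reconstruct n \<tau>) (dist E)) \<le> n * (attach_cost (maxdeg {0..<n} E) \<tau> k + 1)"
proof -
  interpret tl_graph "{0..<n}" E 0 N TE B \<tau> by fact
  define g where "g x = (if x \<in> {0..<n} then lev x else 0)" for x
  define us where "us = sort_key g [1..<n]"
  have us: "set us = {1..<n}" "distinct us" "length us = n - 1" by (auto simp: us_def)
  have "sorted (map g us)" by (simp add: us_def)
  moreover have "map g us = map lev us" using us(1) by (auto simp: g_def)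
  ultimately have "sorted (map lev us)" by (simp only:)
  moreover have "{0} \<union> set us = {0..<n}" unfolding us(1) using n by auto
  moreover have "lev 0 = 0" using dist_0_iff[OF root root] by simp
  ultimately have b: "fst (run (build \<tau> n us {0} (Restr R {0})) (dist E)) = R \<and>
    snd (run (build \<tau> n us {0} (Restr R {0})) (dist E))
      \<le> length us * attach_cost (maxdeg {0..<n} E) \<tau> k"
    by (intro run_build[OF assms(1)]) (use k us in auto)
  have e: "Restr R {0} = {}" using irreflR by auto
  have "run (reconstruct n \<tau>) (dist E) =
    (let r = run (build \<tau> n us {0} {}) (dist E) in (fst r, snd r + n))"
    unfolding reconstruct_def us_def g_def by (subst run_ask) simp_all
  moreover have "length us * attach_cost (maxdeg {0..<n} E) \<tau> k + n
      \<le> n * (attach_cost (maxdeg {0..<n} E) \<tau> k + 1)"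
    using us(3) by (simp add: mult_right_mono)
  ultimately show ?thesis using b unfolding e Let_def by (simp only: fst_conv snd_conv) (meson add_right_mono le_trans)
qed

theorem theorem1:
  shows "\<exists>(alg :: nat \<Rightarrow> nat \<Rightarrow> qtree) (f :: nat \<Rightarrow> nat \<Rightarrow> nat).
    \<forall>(n :: nat) (\<tau> :: nat) (E :: nat \<Rightarrow> nat \<Rightarrow> bool).
      n \<ge> 2 \<and> graph_on {0..<n} E \<and> connected_on {0..<n} E \<and> treelength {0..<n} E \<le> \<tau> \<longrightarrow>
      fst (run (alg n \<tau>) (dist E)) = {(u, v). E u v} \<and>
      real (snd (run (alg n \<tau>) (dist E)))
        \<le> real (f (maxdeg {0..<n} E) \<tau>) * real n * log 2 (real n)"
proof (intro exI allI impI)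
  fix n \<tau> and E :: "nat \<Rightarrow> nat \<Rightarrow> bool"
  assume a: "n \<ge> 2 \<and> graph_on {0..<n} E \<and> connected_on {0..<n} E \<and> treelength {0..<n} E \<le> \<tau>"
  obtain N :: "nat set" and TE B where td: "tree_decomp {0..<n} E N TE B"
    and bags: "\<And>t x y. t \<in> N \<Longrightarrow> x \<in> B t \<Longrightarrow> y \<in> B t \<Longrightarrow> dist E x y \<le> treelength {0..<n} E"
    using treelength_attained[of "{0..<n}" E] a by blast
  have tl: "tl_graph {0..<n} E 0 N TE B \<tau>"
    by unfold_locales (use a td in \<open>auto intro: order_trans[OF bags]\<close>)
  \<comment> \<open>\<open>j\<close> is the integer part of the logarithm; \<open>j + 1\<close>
    bounds the number of halvings.\<close>
  obtain j where j: "2 ^ j \<le> n" "n < 2 ^ (j + 1)" using ex_power_ivl1[of 2 n] a by auto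
  have "j < 2 ^ j" by (rule less_exp)
  with j(1) have jn: "j + 1 \<le> n" by linarith
  define L where "L = log 2 (real n)"
  define D where "D = maxdeg {0..<n} E"
  have "real (2 ^ j) \<le> real n" using j(1) by (rule of_nat_mono)
  then have "real j \<le> L" unfolding L_def using a by (simp add: le_log2_of_power)
  moreover have "1 \<le> L" unfolding L_def using a by (simp add: le_log_iff)
  ultimately have L: "real (j + 1) \<le> 2 * L" "1 \<le> L" by simp_all
  have r: "fst (run (reconstruct n \<tau>) (dist E)) = {(x, y). E x y}"
    "snd (run (reconstruct n \<tau>) (dist E)) \<le> n * (attach_cost D \<tau> (j + 1) + 1)"
    using run_reconstruct[OF tl j(2) jn] a by (auto simp: D_def)
  have "real (attach_cost D \<tau> (j + 1) + 1) =
      real (j + 1) * real (separator_cost D \<tau>) + real ((D + 1) ^ detour \<tau> + 1) * 1"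
    by (simp add: attach_cost_def algebra_simps del: of_nat_power)
  \<comment> \<open>As \<open>1 \<le> L\<close>, the round count is at most \<open>2 * L\<close> and
    constant terms are absorbed by a factor \<open>L\<close>; hence the argument \<open>2\<close> of
    \<open>attach_cost\<close> in the witness for \<open>f\<close>.\<close>
  also have "\<dots> \<le> 2 * L * real (separator_cost D \<tau>) + real ((D + 1) ^ detour \<tau> + 1) * L"
    using L by (intro add_mono mult_right_mono mult_left_mono) auto
  also have "\<dots> = real (attach_cost D \<tau> 2 + 1) * L"
    by (simp add: attach_cost_def algebra_simps del: of_nat_power)
  finally have "real n * real (attach_cost D \<tau> (j + 1) + 1) \<le> real n * (real (attach_cost D \<tau> 2 + 1) * L)"
    by (rule mult_left_mono) simp
  moreover have "real (snd (run (reconstruct n \<tau>) (dist E))) \<le> real n * real (attach_cost D \<tau> (j + 1) + 1)"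
    using of_nat_mono[OF r(2), where 'a = real] by (simp only: of_nat_mult)
  ultimately have "real (snd (run (reconstruct n \<tau>) (dist E)))
      \<le> real (attach_cost D \<tau> 2 + 1) * real n * L" by (simp add: mult_ac)
  then show "fst (run (reconstruct n \<tau>) (dist E)) = {(u, v). E u v} \<and>
      real (snd (run (reconstruct n \<tau>) (dist E)))
        \<le> real ((\<lambda>D \<tau>. attach_cost D \<tau> 2 + 1) (maxdeg {0..<n} E) \<tau>) * real n * log 2 (real n)"
    using r(1) by (simp add: L_def D_def)
qed

end
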